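(* Let $d\ge1$, $0<\alpha<1$ and $\beta>1$. Let $\{X_{\mathbf k},\mathbf k\in\mathbb Z_+^d\}$ be i.i.d. copies of $X$ with $\mathbb EX=0$, $\operatorname{Var}X=\sigma^2<\infty$ and $\mathbb E\big(|X|^{2/\alpha}(\log^+|X|)^{d-1-1/\alpha}\big)<\infty$. For $i\ge1$ let $\mathbf n_i=(\lfloor i^{\beta/(1-\alpha)}\rfloor,\dots,\lfloor i^{\beta/(1-\alpha)}\rfloor)\in\mathbb Z_+^d$ (the diagonal points). Then $$\limsup_{i\to\infty}\frac{T_{\mathbf n_i,\mathbf n_i+\mathbf n_i^\alpha}}{\sqrt{2|\mathbf n_i|^\alpha\log|\mathbf n_i|}}=\sigma\sqrt{\frac{1-\alpha}{d\beta}},\qquad\liminf_{i\to\infty}\frac{T_{\mathbf n_i,\mathbf n_i+\mathbf n_i^\alpha}}{\sqrt{2|\mathbf n_i|^\alpha\log|\mathbf n_i|}}=-\sigma\sqrt{\frac{1-\alpha}{d\beta}}\quad\text{a.s.}$$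
   Context: $\mathbb Z_+^d$ is the set of $d$-tuples of positive integers. $|\mathbf n|=\prod_{k=1}^d n_k$. $\mathbf n^\alpha=(\lfloor n_1^\alpha\rfloor,\dots,\lfloor n_d^\alpha\rfloor)$. For $\mathbf k\in\mathbb Z_{\ge0}^d$, $T_{\mathbf n,\mathbf n+\mathbf k}=\sum X_{\mathbf j}$ over all $\mathbf j\in\mathbb Z_+^d$ with $n_i<j_i\le n_i+k_i$ for every $i$. $\log^+x=\max\{\log x,1\}$. *)

theory Defs
  imports "HOL-Probability.Probability"
begin

definition pos_idx :: "nat \<Rightarrow> nat list set" where
  "pos_idx d = {k. length k = d \<and> (\<forall>x\<in>set k. 0 < x)}"

definition idx_size :: "nat list \<Rightarrow> nat" where
  "idx_size n = prod_list n"

definition idx_pow :: "real \<Rightarrow> nat list \<Rightarrow> nat list" where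
  "idx_pow \<alpha> n = map (\<lambda>x. nat \<lfloor>real x powr \<alpha>\<rfloor>) n"

definition block_sum :: "(nat list \<Rightarrow> 'a \<Rightarrow> real) \<Rightarrow> nat list \<Rightarrow> nat list \<Rightarrow> 'a \<Rightarrow> real" where
  "block_sum X n k \<omega> =
     (\<Sum>j\<in>{j. length j = length n \<and> (\<forall>i<length n. n!i < j!i \<and> j!i \<le> n!i + k!i)}. X j \<omega>)"

definition log_plus :: "real \<Rightarrow> real" where
  "log_plus x = max (ln x) 1"

end

theory Submission
  imports Defs "HOL-Real_Asymp.Real_Asymp"
begin

text \<open>Since \<open>\<beta> > 1\<close>, the cubes are eventually disjoint, so the block sums \<open>S\<^sub>i\<close> are eventually independent; the
  \<open>i\<close>-th one has \<open>m\<^sub>i \<sim> i\<^bsup>\<gamma>\<^esup>\<close> summands with \<open>\<gamma> = d\<alpha>\<beta>/(1-\<alpha>)\<close>. By the Borel--Cantelli lemmas it suffices that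
  \<open>P(S\<^sub>i > s\<surd>(2m\<^sub>i ln i))\<close> is summable for \<open>s > \<sigma>\<close> and not summable for \<open>s < \<sigma>\<close>.

  For \<open>s > \<sigma>\<close>, truncate at a small multiple of \<open>\<surd>(m\<^sub>i/ln i)\<close>: the truncated sum obeys a Gaussian
  exponential bound, and the exceedances are summable because a moment of order \<open>p > 2 + 2/\<gamma>\<close> is
  finite, which the hypothesis provides as \<open>2 + 2/\<gamma> < 2/\<alpha>\<close>. For \<open>s < \<sigma>\<close>, cut the sum into about \<open>c ln i\<close>
  pieces of equal length; by the central limit theorem each piece exceeds its share with probability at least
  \<open>exp(-\<kappa>t\<^sup>2/2)\<close>, \<open>\<kappa>\<close> close to \<open>1\<close>, and independence multiplies these bounds to a constant times \<open>1/i\<close>.\<close>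

section \<open>The second Borel--Cantelli lemma and a quadratic bound for the exponential
  function\<close>

text \<open>If with positive probability no event occurs from \<open>n\<close> on, the inequality 1
  - p <= exp(-p) bounds every partial sum of the probabilities from \<open>n\<close> on by -ln of
  that probability, so the series would converge. Independence is asked only from \<open>n0\<close>
  on, because the cubes are disjoint only from some index on.\<close>

lemma (in prob_space) borel_cantelli_AE2:
  fixes S :: "nat \<Rightarrow> 'a \<Rightarrow> real"
  assumes indep: "indep_vars (\<lambda>_. borel) S {n0..}"
    and B: "\<And>i. B i \<in> sets borel"
    and nsum: "\<not> summable (\<lambda>i. prob (S i -` B i \<inter> space M))"
  shows "AE \<omega> in M. \<exists>\<^sub>F i in sequentially. S i \<omega> \<in> B i"
proof -
  let ?p = "\<lambda>i. prob (S i -` B i \<inter> space M)"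
  have rv: "random_variable borel (S i)" if "i \<ge> n0" for i
    using indep that by (auto simp: indep_vars_def)
  have ev: "S i -` (- B i) \<inter> space M \<in> events" if "i \<ge> n0" for i
    using measurable_sets[OF rv[OF that], of "- B i"] B[of i] by auto
  have "AE \<omega> in M. \<exists>k\<ge>n. S k \<omega> \<in> B k" if n: "n \<ge> n0" for n
  proof -
    define E where "E = (\<Inter>k\<in>{n..}. S k -` (- B k) \<inter> space M)"
    have Em: "E \<in> events"
      unfolding E_def using n ev by (intro sets.countable_INT) auto
    have bound: "prob E \<le> exp (- (\<Sum>k\<in>{n..N}. ?p k))" if "N \<ge> n" for N
    proof -
      have "prob E \<le> prob (\<Inter>k\<in>{n..N}. S k -` (- B k) \<inter> space M)"
        unfolding E_def using that n ev
        by (intro finite_measure_mono sets.countable_INT) auto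
      also have "\<dots> = (\<Prod>k\<in>{n..N}. prob (S k -` (- B k) \<inter> space M))"
        using that n B by (intro indep_varsD[OF indep]) auto
      also have "\<dots> \<le> (\<Prod>k\<in>{n..N}. exp (- ?p k))"
      proof (intro prod_mono conjI)
        fix k assume k: "k \<in> {n..N}"
        have "prob (S k -` (- B k) \<inter> space M) = prob (space M - (S k -` B k \<inter> space M))"
          by (rule arg_cong[where f=prob]) auto
        also have "\<dots> = 1 - ?p k"
          using rv[of k] B k n by (intro prob_compl measurable_sets) auto
        also have "\<dots> \<le> exp (- ?p k)"
          using exp_ge_add_one_self[of "- ?p k"] by simp
        finally show "prob (S k -` (- B k) \<inter> space M) \<le> exp (- ?p k)" .
      qed simp
      also have "\<dots> = exp (- (\<Sum>k\<in>{n..N}. ?p k))"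
        by (simp add: exp_sum sum_negf[symmetric])
      finally show ?thesis .
    qed
    have "prob E = 0"
    proof (rule ccontr)
      assume "prob E \<noteq> 0"
      then have pos: "prob E > 0" by (simp add: order_less_le)
      have "summable (\<lambda>k. ?p (k + n))"
      proof (rule summableI_nonneg_bounded)
        fix N
        have "(\<Sum>k<N. ?p (k + n)) \<le> (\<Sum>k\<in>{n..N+n}. ?p k)"
          by (subst sum.shift_bounds_nat_ivl[of _ 0 n N, simplified lessThan_atLeast0[symmetric], symmetric, simplified])
             (auto intro!: sum_mono2)
        also have "\<dots> \<le> - ln (prob E)"
          using bound[of "N+n"] pos ln_le_cancel_iff[of "prob E" "exp (- (\<Sum>k\<in>{n..N+n}. ?p k))"]
          by simp
        finally show "(\<Sum>k<N. ?p (k + n)) \<le> - ln (prob E)" .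
      qed simp
      with nsum show False using summable_iff_shift[of ?p n] by simp
    qed
    with Em have "AE \<omega> in M. \<omega> \<notin> E" by (simp add: prob_eq_0)
    then show ?thesis by (rule AE_mp) (auto simp: E_def)
  qed
  then have "AE \<omega> in M. \<forall>n\<ge>n0. \<exists>k\<ge>n. S k \<omega> \<in> B k"
    by (simp add: AE_all_countable)
  then show ?thesis
  proof (rule AE_mp, intro AE_I2 impI)
    fix \<omega> assume "\<forall>n\<ge>n0. \<exists>k\<ge>n. S k \<omega> \<in> B k"
    then show "\<exists>\<^sub>F i in sequentially. S i \<omega> \<in> B i"
      unfolding frequently_sequentially by (meson le_trans nle_le)
  qed
qed

text \<open>Taylor's formula with Lagrange remainder: the remainder is evaluated at a point not
  above \<open>\<delta>\<close>. Only an upper bound on \<open>y\<close> enters, so truncation from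
  above will suffice.\<close>

lemma exp_le_quadratic:
  fixes y \<delta> :: real
  assumes "y \<le> \<delta>" "0 \<le> \<delta>"
  shows "exp y \<le> 1 + y + y\<^sup>2 / 2 * exp \<delta>"
proof (cases "y < 0")
  case True
  obtain t where t: "t < 0" "exp y = (\<Sum>m<2. exp 0 / fact m * y ^ m) + exp t / fact 2 * y ^ 2"
    using Maclaurin_minus[OF True, of 2 "\<lambda>_. exp" exp] by auto
  have "exp t * y\<^sup>2 \<le> exp \<delta> * y\<^sup>2"
    using t(1) assms by (intro mult_right_mono) auto
  then show ?thesis using t(2) by (simp add: numeral_2_eq_2 field_simps)
next
  case False
  obtain t where t: "\<bar>t\<bar> \<le> \<bar>y\<bar>" "exp y = (\<Sum>m<2. y ^ m / fact m) + exp t / fact 2 * y ^ 2"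
    using Maclaurin_exp_le by blast
  have "exp t * y\<^sup>2 \<le> exp \<delta> * y\<^sup>2"
    using t(1) assms False by (intro mult_right_mono) auto
  then show ?thesis using t(2) by (simp add: numeral_2_eq_2 field_simps)
qed

section \<open>Independent identically distributed families: laws of sums\<close>

text \<open>The common law \<open>\<mu>\<close> is a parameter, so that moment conditions are stated
  once for the whole family; the locale is entered a second time with the negated variables.\<close>

locale iid_family = prob_space M for M :: "'a measure" +
  fixes X :: "'i \<Rightarrow> 'a \<Rightarrow> real" and I :: "'i set" and \<mu> :: "real measure"
  assumes indep: "indep_vars (\<lambda>_. borel) X I"
    and ident: "\<And>k. k \<in> I \<Longrightarrow> distr M borel (X k) = \<mu>"
begin

lemma rv [measurable]: "k \<in> I \<Longrightarrow> random_variable borel (X k)"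
  using indep by (auto simp: indep_vars_def)

lemma rv_sum: "J \<subseteq> I \<Longrightarrow> random_variable borel (\<lambda>\<omega>. \<Sum>k\<in>J. X k \<omega>)"
  using rv by (intro borel_measurable_sum) auto

lemma event_sum_gt: "J \<subseteq> I \<Longrightarrow> {\<omega> \<in> space M. (\<Sum>k\<in>J. X k \<omega>) > x} \<in> events"
  using rv_sum[of J] by measurable

lemma indep_sums:
  assumes "\<And>i. i \<in> L \<Longrightarrow> J i \<subseteq> I" "disjoint_family_on J L"
  shows "indep_vars (\<lambda>_. borel) (\<lambda>i \<omega>. \<Sum>k\<in>J i. X k \<omega>) L"
proof -
  \<comment> \<open>\<open>indep_vars_restrict\<close> gives independence of the restrictions to the
    disjoint groups \<open>J i\<close>; each block sum is a measurable function of its own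
    group.\<close>
  have "indep_vars (\<lambda>_. borel) (\<lambda>i \<omega>. \<Sum>k\<in>J i. restrict (\<lambda>k. X k \<omega>) (J i) k) L"
    by (rule indep_vars_compose2[OF indep_vars_restrict[OF indep assms],
          where Y = "\<lambda>i f. \<Sum>k\<in>J i. f k"]) auto
  then show ?thesis by (simp cong: sum.cong)
qed

text \<open>The characteristic function of a sum depends on the index set through its cardinality
  only, and Levy's uniqueness theorem turns this into equality of laws. Infinite sets are covered by
  the conventions that their sum and their cardinality are 0.\<close>

lemma prob_sum_gt_cong:
  assumes "A \<subseteq> I" "B \<subseteq> I" "card A = card B"
  shows "\<P>(\<omega> in M. (\<Sum>k\<in>A. X k \<omega>) > x) = \<P>(\<omega> in M. (\<Sum>k\<in>B. X k \<omega>) > x)"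
proof -
  have *: "char (distr M borel (\<lambda>\<omega>. \<Sum>k\<in>J. X k \<omega>)) = (\<lambda>t. char \<mu> t ^ card J)" if "J \<subseteq> I" for J
    using that indep_vars_subset[OF indep that] by (auto simp: fun_eq_iff char_distr_sum ident subset_iff)
  have "distr M borel (\<lambda>\<omega>. \<Sum>k\<in>A. X k \<omega>) = distr M borel (\<lambda>\<omega>. \<Sum>k\<in>B. X k \<omega>)"
    using assms by (intro Levy_uniqueness real_distribution_distr rv_sum) (simp_all add: *)
  then have "measure (distr M borel (\<lambda>\<omega>. \<Sum>k\<in>A. X k \<omega>)) {x<..} = measure (distr M borel (\<lambda>\<omega>. \<Sum>k\<in>B. X k \<omega>)) {x<..}"
    by simp
  then show ?thesis
    using assms rv_sum[of A] rv_sum[of B]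
    by (simp add: measure_distr vimage_def Int_def conj_commute)
qed

text \<open>The two events are independent, and together they force the sum over the union above
  \<open>x + y\<close>.\<close>

lemma prob_sum_gt_union:
  assumes "A \<subseteq> I" "B \<subseteq> I" "A \<inter> B = {}" "finite A" "finite B"
  shows "\<P>(\<omega> in M. (\<Sum>k\<in>A. X k \<omega>) > x) * \<P>(\<omega> in M. (\<Sum>k\<in>B. X k \<omega>) > y)
    \<le> \<P>(\<omega> in M. (\<Sum>k\<in>A \<union> B. X k \<omega>) > x + y)"
proof -
  \<comment> \<open>Indexing the two sums by \<open>bool\<close> puts them into one family, to which
    \<open>indep_sums\<close> applies.\<close>
  have ind: "indep_vars (\<lambda>_. borel) (\<lambda>b \<omega>. \<Sum>k\<in>case_bool A B b. X k \<omega>) UNIV"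
    using assms by (intro indep_sums) (auto simp: disjoint_family_on_def split: bool.split)
  have "\<P>(\<omega> in M. (\<Sum>k\<in>A. X k \<omega>) > x) * \<P>(\<omega> in M. (\<Sum>k\<in>B. X k \<omega>) > y)
    = (\<Prod>b\<in>UNIV. prob ((\<lambda>\<omega>. \<Sum>k\<in>case_bool A B b. X k \<omega>) -` {case_bool x y b<..} \<inter> space M))"
    by (simp add: UNIV_bool vimage_def Int_def conj_commute)
  also have "\<dots> = prob (\<Inter>b\<in>UNIV. (\<lambda>\<omega>. \<Sum>k\<in>case_bool A B b. X k \<omega>) -` {case_bool x y b<..} \<inter> space M)"
    by (intro indep_varsD[OF ind, symmetric]) auto
  also have "\<dots> \<le> \<P>(\<omega> in M. (\<Sum>k\<in>A \<union> B. X k \<omega>) > x + y)"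
    using assms by (intro finite_measure_mono event_sum_gt)
      (auto simp: UNIV_bool sum.union_disjoint)
  finally show ?thesis .
qed

section \<open>Upper bounds for the tails: truncation and exponential moments\<close>

lemma integrable_family:
  fixes g :: "real \<Rightarrow> real"
  assumes "integrable \<mu> g" "g \<in> borel_measurable borel" "k \<in> I"
  shows "integrable M (\<lambda>\<omega>. g (X k \<omega>))"
  using assms integrable_distr_eq[of "X k" M borel g] rv[of k] ident[of k] by simp

lemma expectation_family:
  fixes g :: "real \<Rightarrow> real"
  assumes "g \<in> borel_measurable borel" "k \<in> I"
  shows "expectation (\<lambda>\<omega>. g (X k \<omega>)) = (\<integral>x. g x \<partial>\<mu>)"
  using assms integral_distr[of "X k" M borel g] rv[of k] ident[of k] by simp

text \<open>The truncation is one-sided: dropping the summands above \<open>\<tau>\<close> only lowers the mean,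
  so no recentring is needed in the exponential Markov bound.\<close>

lemma prob_sum_gt_truncation:
  assumes J: "J \<subseteq> I" "finite J"
    and int1: "integrable \<mu> (\<lambda>x. x)" "(\<integral>x. x \<partial>\<mu>) = 0"
    and int2: "integrable \<mu> (\<lambda>x. x\<^sup>2)" "(\<integral>x. x\<^sup>2 \<partial>\<mu>) = v"
    and intp: "integrable \<mu> (\<lambda>x. \<bar>x\<bar> powr p)" and p: "p > 0"
    and pos: "\<theta> > 0" "\<tau> > 0" "\<theta> * \<tau> \<le> \<delta>"
  shows "\<P>(\<omega> in M. (\<Sum>k\<in>J. X k \<omega>) > x) \<le>
    real (card J) * ((\<integral>x. \<bar>x\<bar> powr p \<partial>\<mu>) / \<tau> powr p)
      + exp (- \<theta> * x + real (card J) * (\<theta>\<^sup>2 * v / 2 * exp \<delta>))"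
proof -
  define g :: "real \<Rightarrow> real" where "g x = x * indicator {..\<tau>} x" for x
  have [measurable]: "g \<in> borel_measurable borel" unfolding g_def by measurable
  have \<delta>: "\<delta> \<ge> 0" using pos by (smt (verit) mult_pos_pos)
  let ?c = "exp (\<theta>\<^sup>2 * v / 2 * exp \<delta>)"
  have tail: "\<P>(\<omega> in M. X k \<omega> > \<tau>) \<le> (\<integral>x. \<bar>x\<bar> powr p \<partial>\<mu>) / \<tau> powr p" if k: "k \<in> J" for k
  proof -
    have kI: "k \<in> I" using k J by auto
    have "\<P>(\<omega> in M. X k \<omega> > \<tau>) \<le> \<P>(\<omega> in M. \<bar>X k \<omega>\<bar> powr p \<ge> \<tau> powr p)"
      using rv[OF kI] pos p
      by (intro finite_measure_mono) (auto intro!: powr_mono2)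
    also have "\<dots> \<le> expectation (\<lambda>\<omega>. \<bar>X k \<omega>\<bar> powr p) / \<tau> powr p"
      using pos integrable_family[OF intp _ kI]
      by (intro integral_Markov_inequality_measure[where A = "{}"]) auto
    finally show ?thesis using expectation_family[of "\<lambda>x. \<bar>x\<bar> powr p", OF _ kI] by simp
  qed
  have mgf: "integrable M (\<lambda>\<omega>. exp (\<theta> * g (X k \<omega>)))"
    "expectation (\<lambda>\<omega>. exp (\<theta> * g (X k \<omega>))) \<le> ?c" if k: "k \<in> J" for k
  proof -
    have kI: "k \<in> I" using k J by auto
    note [measurable] = rv[OF kI]
    have le: "\<theta> * g x \<le> \<delta>" for x
    proof (cases "x \<le> \<tau>")
      case True
      then have "\<theta> * x \<le> \<theta> * \<tau>" using pos by (intro mult_left_mono) auto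
      also note pos(3)
      finally show ?thesis using True by (simp add: g_def)
    qed (use \<delta> in \<open>simp add: g_def\<close>)
    show int: "integrable M (\<lambda>\<omega>. exp (\<theta> * g (X k \<omega>)))"
      by (rule integrable_const_bound[where B = "exp \<delta>"]) (auto simp: le)
    \<comment> \<open>Here \<open>g x \<le> x\<close> because \<open>\<tau> > 0\<close>, and the
      square of \<open>g x\<close> is at most that of \<open>x\<close>; so the truncated variable is
      bounded through the untruncated moments 0 and \<open>v\<close>.\<close>
    have pt: "exp (\<theta> * g x) \<le> 1 + \<theta> * x + x\<^sup>2 * (\<theta>\<^sup>2 / 2 * exp \<delta>)" for x
    proof -
      have A: "exp (\<theta> * g x) \<le> 1 + \<theta> * g x + (\<theta> * g x)\<^sup>2 / 2 * exp \<delta>"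
        by (rule exp_le_quadratic[OF le \<delta>])
      have B: "\<theta> * g x \<le> \<theta> * x"
        using pos by (auto simp: g_def indicator_def)
      have "(\<theta> * g x)\<^sup>2 / 2 * exp \<delta> \<le> (\<theta> * x)\<^sup>2 / 2 * exp \<delta>"
        by (auto simp: g_def indicator_def)
      with A B have "exp (\<theta> * g x) \<le> 1 + \<theta> * x + (\<theta> * x)\<^sup>2 / 2 * exp \<delta>" by linarith
      then show ?thesis by (simp add: power_mult_distrib algebra_simps)
    qed
    have i1: "integrable M (X k)" "expectation (X k) = 0"
      using integrable_family[OF int1(1) _ kI] expectation_family[of "\<lambda>x. x", OF _ kI] int1(2) by auto
    have i2: "integrable M (\<lambda>\<omega>. (X k \<omega>)\<^sup>2)" "expectation (\<lambda>\<omega>. (X k \<omega>)\<^sup>2) = v"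
      using integrable_family[OF int2(1) _ kI] expectation_family[of "\<lambda>x. x\<^sup>2", OF _ kI] int2(2) by auto
    have "expectation (\<lambda>\<omega>. exp (\<theta> * g (X k \<omega>)))
      \<le> expectation (\<lambda>\<omega>. 1 + \<theta> * X k \<omega> + (X k \<omega>)\<^sup>2 * (\<theta>\<^sup>2 / 2 * exp \<delta>))"
      using i1 i2 int pt by (intro integral_mono) auto
    also have "\<dots> = 1 + v * (\<theta>\<^sup>2 / 2 * exp \<delta>)"
      using i1 i2 by (simp add: prob_space)
    also have "\<dots> \<le> ?c"
      using exp_ge_add_one_self[of "v * (\<theta>\<^sup>2 / 2 * exp \<delta>)"] by (simp add: mult_ac)
    finally show "expectation (\<lambda>\<omega>. exp (\<theta> * g (X k \<omega>))) \<le> ?c" .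
  qed
  have ind: "indep_vars (\<lambda>_. borel) (\<lambda>k \<omega>. exp (\<theta> * g (X k \<omega>))) J"
    by (rule indep_vars_compose2[OF indep_vars_subset[OF indep J(1)]]) measurable
  note int_prod = indep_vars_integrable[OF J(2) ind mgf(1)]
  have rvJ: "random_variable borel (X k)" if "k \<in> J" for k using that J rv by auto
  have m: "{\<omega> \<in> space M. X k \<omega> > \<tau>} \<in> events" if "k \<in> J" for k
    using rvJ[OF that] by measurable
  have m2: "{\<omega> \<in> space M. (\<Sum>k\<in>J. g (X k \<omega>)) > x} \<in> events"
  proof -
    have "(\<lambda>\<omega>. \<Sum>k\<in>J. g (X k \<omega>)) \<in> borel_measurable M"
      using rvJ by (intro borel_measurable_sum measurable_compose[of _ M borel g]) auto
    then show ?thesis by measurable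
  qed
  \<comment> \<open>Either some summand exceeds \<open>\<tau>\<close>, which a union bound and
    Markov's inequality for the \<open>p\<close>-th moment control, or the truncated sum is the full
    sum and the exponential Markov inequality applies.\<close>
  have "\<P>(\<omega> in M. (\<Sum>k\<in>J. X k \<omega>) > x)
    \<le> prob ((\<Union>k\<in>J. {\<omega> \<in> space M. X k \<omega> > \<tau>}) \<union> {\<omega> \<in> space M. (\<Sum>k\<in>J. g (X k \<omega>)) > x})"
  proof (rule finite_measure_mono)
    have "(\<Sum>k\<in>J. g (X k \<omega>)) = (\<Sum>k\<in>J. X k \<omega>)" if "\<forall>k\<in>J. X k \<omega> \<le> \<tau>" for \<omega>
      using that by (intro sum.cong) (auto simp: g_def)
    then show "{\<omega> \<in> space M. (\<Sum>k\<in>J. X k \<omega>) > x}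
      \<subseteq> (\<Union>k\<in>J. {\<omega> \<in> space M. X k \<omega> > \<tau>}) \<union> {\<omega> \<in> space M. (\<Sum>k\<in>J. g (X k \<omega>)) > x}"
      by (auto simp: not_less)
  qed (intro sets.Un sets.finite_UN m m2 J)
  also have "\<dots> \<le> prob (\<Union>k\<in>J. {\<omega> \<in> space M. X k \<omega> > \<tau>}) + \<P>(\<omega> in M. (\<Sum>k\<in>J. g (X k \<omega>)) > x)"
    by (intro measure_Un_le sets.finite_UN m m2 J)
  also have "prob (\<Union>k\<in>J. {\<omega> \<in> space M. X k \<omega> > \<tau>}) \<le> (\<Sum>k\<in>J. \<P>(\<omega> in M. X k \<omega> > \<tau>))"
    using m J by (intro finite_measure_subadditive_finite) auto
  also have "\<dots> \<le> (\<Sum>k\<in>J. (\<integral>x. \<bar>x\<bar> powr p \<partial>\<mu>) / \<tau> powr p)"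
    by (intro sum_mono tail)
  also have "\<dots> = real (card J) * ((\<integral>x. \<bar>x\<bar> powr p \<partial>\<mu>) / \<tau> powr p)" by simp
  also have "\<P>(\<omega> in M. (\<Sum>k\<in>J. g (X k \<omega>)) > x)
    \<le> \<P>(\<omega> in M. (\<Prod>k\<in>J. exp (\<theta> * g (X k \<omega>))) \<ge> exp (\<theta> * x))"
  proof (rule finite_measure_mono)
    show "{\<omega> \<in> space M. (\<Prod>k\<in>J. exp (\<theta> * g (X k \<omega>))) \<ge> exp (\<theta> * x)} \<in> events"
      using borel_measurable_integrable[OF int_prod] by measurable
  qed (use pos J(2) in \<open>auto simp: exp_sum[symmetric] sum_distrib_left[symmetric]\<close>)
  also have "\<dots> \<le> expectation (\<lambda>\<omega>. \<Prod>k\<in>J. exp (\<theta> * g (X k \<omega>))) / exp (\<theta> * x)"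
    using int_prod by (intro integral_Markov_inequality_measure[where A = "{}"]) (auto intro!: prod_nonneg)
  also have "expectation (\<lambda>\<omega>. \<Prod>k\<in>J. exp (\<theta> * g (X k \<omega>))) = (\<Prod>k\<in>J. expectation (\<lambda>\<omega>. exp (\<theta> * g (X k \<omega>))))"
    by (rule indep_vars_lebesgue_integral[OF J(2) ind mgf(1)])
  also have "\<dots> \<le> (\<Prod>k\<in>J. ?c)"
    using mgf by (intro prod_mono) auto
  also have "(\<Prod>k\<in>J. ?c) / exp (\<theta> * x) = exp (- \<theta> * x + real (card J) * (\<theta>\<^sup>2 * v / 2 * exp \<delta>))"
    by (simp add: exp_of_nat_mult[symmetric] exp_diff[symmetric])
  finally show ?thesis by (simp add: divide_right_mono)
qed

text \<open>The truncation bound is applied with parameters tied by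
  \<open>\<theta> * \<tau> = \<delta>\<close>. With m = \<open>card (J i)\<close> and L = ln i its
  exponential part becomes \<open>i powr (- \<kappa>)\<close> with \<open>\<kappa> > 1\<close>. Its
  truncation part is of order m^(1 - p/2) * L^(p/2), hence at most of order i^(-b) * L^(p/2) with b
  > 1.\<close>

lemma summable_prob_sum_gt:
  fixes J :: "nat \<Rightarrow> 'i set"
  assumes J: "\<And>i. J i \<subseteq> I" "\<And>i. finite (J i)"
    and int1: "integrable \<mu> (\<lambda>x. x)" "(\<integral>x. x \<partial>\<mu>) = 0"
    and int2: "integrable \<mu> (\<lambda>x. x\<^sup>2)" "(\<integral>x. x\<^sup>2 \<partial>\<mu>) = v"
    and intp: "integrable \<mu> (\<lambda>x. \<bar>x\<bar> powr p)"
    and growth: "c > 0" "\<forall>\<^sub>F i in sequentially. c * real i powr \<gamma> \<le> real (card (J i))"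
    and p: "p > 2" "\<gamma> * (p / 2 - 1) > 1"
    and s: "s > 0" "v < s\<^sup>2"
  shows "summable (\<lambda>i. \<P>(\<omega> in M. (\<Sum>k\<in>J i. X k \<omega>) > s * sqrt (2 * real (card (J i)) * ln (real i))))"
proof -
  define m where "m i = real (card (J i))" for i
  define K where "K = (\<integral>x. \<bar>x\<bar> powr p \<partial>\<mu>)"
  have K: "K \<ge> 0" unfolding K_def by simp
  \<comment> \<open>The factor \<open>exp \<delta>\<close> is the price of truncation in the
    variance; \<open>v < s\<^sup>2\<close> leaves room for it when \<open>\<delta>\<close> is
    small.\<close>
  obtain \<delta> where \<delta>: "\<delta> > 0" "v / s\<^sup>2 * exp \<delta> < 1"
  proof -
    have "((\<lambda>\<delta>. v / s\<^sup>2 * exp \<delta>) \<longlongrightarrow> v / s\<^sup>2 * exp 0) (at_right 0)"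
      by (intro tendsto_intros)
    moreover have "v / s\<^sup>2 * exp 0 < 1" using s by simp
    ultimately have "\<forall>\<^sub>F \<delta> in at_right 0. v / s\<^sup>2 * exp \<delta> < 1"
      by (rule order_tendstoD)
    moreover have "\<forall>\<^sub>F \<delta>::real in at_right 0. \<delta> > 0"
      by (rule eventually_at_right_less)
    ultimately have "\<forall>\<^sub>F \<delta> in at_right 0. \<delta> > 0 \<and> v / s\<^sup>2 * exp \<delta> < 1"
      by eventually_elim simp
    then show ?thesis using that eventually_happens'[OF trivial_limit_at_right_real] by blast
  qed
  define \<kappa> where "\<kappa> = 2 - v / s\<^sup>2 * exp \<delta>"
  have \<kappa>: "\<kappa> > 1" using \<delta> by (simp add: \<kappa>_def)
  define b where "b = \<gamma> * (p / 2 - 1)"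
  define C where "C = K / (\<delta> * s / sqrt 2) powr p * c powr (1 - p / 2)"
  define h where "h i = C * (real i powr (- b) * ln (real i) powr (p / 2)) + real i powr (- \<kappa>)" for i
  have "summable (\<lambda>i::nat. real i powr (- b) * ln (real i) powr (p / 2))"
  proof (rule summable_comparison_test_ev)
    have b: "b > 1" using p by (simp add: b_def)
    \<comment> \<open>The power of the logarithm is absorbed by half of the excess
      \<open>b - 1\<close>, leaving the exponent -(b + 1)/2, still below -1.\<close>
    have "\<forall>\<^sub>F i::nat in sequentially. ln (real i) powr (p / 2) \<le> real i powr ((b - 1) / 2)"
      using b p by real_asymp
    then show "\<forall>\<^sub>F i in sequentially. norm (real i powr (- b) * ln (real i) powr (p / 2)) \<le> real i powr (- (b + 1) / 2)"
    proof eventually_elim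
      case (elim i)
      have "real i powr (- b) * ln (real i) powr (p / 2) \<le> real i powr (- b) * real i powr ((b - 1) / 2)"
        using elim by (intro mult_left_mono) auto
      also have "\<dots> = real i powr (- (b + 1) / 2)"
        by (simp add: powr_add[symmetric] field_simps)
      finally show ?case by simp
    qed
    show "summable (\<lambda>i. real i powr (- (b + 1) / 2))"
      using b by (simp add: summable_real_powr_iff)
  qed
  then have sumh: "summable h"
    unfolding h_def using \<kappa> by (intro summable_add summable_mult) (auto simp: summable_real_powr_iff)
  show ?thesis
  proof (rule summable_comparison_test_ev[OF _ sumh])
    show "\<forall>\<^sub>F i in sequentially. norm (\<P>(\<omega> in M. (\<Sum>k\<in>J i. X k \<omega>) > s * sqrt (2 * real (card (J i)) * ln (real i)))) \<le> h i"
      using growth(2) eventually_ge_at_top[of 3]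
    proof eventually_elim
      case (elim i)
      define L where "L = ln (real i)"
      have L: "L > 0" using elim by (simp add: L_def)
      have mi: "m i \<ge> c * real i powr \<gamma>" using elim by (simp add: m_def)
      have mpos: "m i > 0" using mi elim growth(1)
        by (smt (verit, best) mult_pos_pos of_nat_0_less_iff powr_gt_zero zero_less_numeral less_le_trans)
      \<comment> \<open>This \<open>\<theta>\<close> minimises -\<theta>*x + m*\<theta>^2*s^2/2 at x
        = s*sqrt(2*m*L); \<open>\<tau>\<close> is then the largest level with
        \<open>\<theta> * \<tau> \<le> \<delta>\<close>.\<close>
      define \<theta> where "\<theta> = sqrt (2 * L / m i) / s"
      define \<tau> where "\<tau> = \<delta> * s * sqrt (m i / (2 * L))"
      have pos: "\<theta> > 0" "\<tau> > 0" using L mpos \<delta> s by (auto simp: \<theta>_def \<tau>_def)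
      have "\<theta> * \<tau> = \<delta> * (sqrt (2 * L / m i) * sqrt (m i / (2 * L)))"
        using s by (simp add: \<theta>_def \<tau>_def)
      also have "\<dots> = \<delta>" using L mpos by (simp add: real_sqrt_mult[symmetric])
      finally have lt: "\<theta> * \<tau> \<le> \<delta>" by simp
      have e1: "\<theta> * (s * sqrt (2 * m i * L)) = 2 * L"
      proof -
        have "\<theta> * (s * sqrt (2 * m i * L)) = sqrt (2 * L / m i) * sqrt (2 * m i * L)"
          using s by (simp add: \<theta>_def)
        also have "\<dots> = sqrt ((2 * L)\<^sup>2)"
          using mpos by (simp add: real_sqrt_mult[symmetric] power2_eq_square field_simps)
        also have "\<dots> = 2 * L" using L by (intro real_sqrt_unique) auto
        finally show ?thesis .
      qed
      have e2: "m i * (\<theta>\<^sup>2 * v / 2 * exp \<delta>) = L * (v / s\<^sup>2 * exp \<delta>)"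
        using mpos L s by (simp add: \<theta>_def power_divide field_simps)
      have "- \<theta> * (s * sqrt (2 * m i * L)) + m i * (\<theta>\<^sup>2 * v / 2 * exp \<delta>) = - \<kappa> * L"
        using e1 e2 by (simp add: \<kappa>_def algebra_simps)
      then have E: "exp (- \<theta> * (s * sqrt (2 * m i * L)) + m i * (\<theta>\<^sup>2 * v / 2 * exp \<delta>)) = real i powr (- \<kappa>)"
        using elim by (simp add: powr_def L_def)
      have tp: "\<tau> powr p = (\<delta> * s / sqrt 2) powr p * m i powr (p / 2) / L powr (p / 2)"
      proof -
        have "\<tau> = (\<delta> * s / sqrt 2) * (m i powr (1/2) / L powr (1/2))"
          using mpos L by (simp add: \<tau>_def powr_half_sqrt real_sqrt_divide real_sqrt_mult)
        then show ?thesis using mpos L \<delta> s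
          by (simp add: powr_mult powr_divide powr_powr)
      qed
      have "m i * (K / \<tau> powr p) = K / (\<delta> * s / sqrt 2) powr p * (m i powr (1 - p / 2)) * L powr (p / 2)"
        unfolding tp using mpos by (simp add: powr_diff)
      \<comment> \<open>The exponent \<open>1 - p / 2\<close> is negative, so the lower bound on the
        cardinality gives an upper bound here.\<close>
      also have "\<dots> \<le> K / (\<delta> * s / sqrt 2) powr p * ((c * real i powr \<gamma>) powr (1 - p / 2)) * L powr (p / 2)"
        using mi K p growth(1) elim
        by (intro mult_right_mono mult_left_mono powr_mono2') auto
      also have "(c * real i powr \<gamma>) powr (1 - p / 2) = c powr (1 - p / 2) * real i powr (- b)"
        using growth(1) by (simp add: powr_mult powr_powr b_def algebra_simps)
      finally have T: "m i * (K / \<tau> powr p) \<le> C * (real i powr (- b) * L powr (p / 2))"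
        by (simp add: C_def mult_ac)
      have "\<P>(\<omega> in M. (\<Sum>k\<in>J i. X k \<omega>) > s * sqrt (2 * m i * L)) \<le>
        m i * (K / \<tau> powr p) + exp (- \<theta> * (s * sqrt (2 * m i * L)) + m i * (\<theta>\<^sup>2 * v / 2 * exp \<delta>))"
        unfolding m_def K_def using p
        by (intro prob_sum_gt_truncation J int1 int2 intp pos lt) auto
      also have "\<dots> \<le> h i"
        using T unfolding E h_def by (simp add: L_def)
      finally show ?case by (simp add: L_def m_def)
    qed
  qed
qed

end

section \<open>Lower bounds for the tails: the central limit theorem applied to pieces\<close>

text \<open>The density decreases on the nonnegative half-line, so on the unit interval after
  \<open>t\<close> it stays above its value at the right end.\<close>

lemma std_normal_tail_ge:
  assumes "t \<ge> 0"
  shows "std_normal_density (t + 1) \<le> measure std_normal_distribution {t<..}"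
proof -
  interpret N: prob_space std_normal_distribution by (rule prob_space_normal_density) simp
  have "ennreal (std_normal_density (t + 1)) = (\<integral>\<^sup>+x. ennreal (std_normal_density (t + 1)) * indicator {t<..t+1} x \<partial>lborel)"
    by (simp add: nn_integral_cmult_indicator)
  also have "\<dots> \<le> (\<integral>\<^sup>+x. ennreal (std_normal_density x) * indicator {t<..} x \<partial>lborel)"
  proof (intro nn_integral_mono)
    fix x
    have "std_normal_density (t + 1) \<le> std_normal_density x" if "t < x" "x \<le> t + 1"
      using that assms by (auto simp: std_normal_density_def intro!: divide_right_mono power_mono)
    then show "ennreal (std_normal_density (t + 1)) * indicator {t<..t+1} x
      \<le> ennreal (std_normal_density x) * indicator {t<..} x"
      by (auto simp: indicator_def intro!: ennreal_leI)
  qed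
  also have "\<dots> = emeasure std_normal_distribution {t<..}"
    by (subst emeasure_density) auto
  finally show ?thesis
    by (simp add: N.emeasure_eq_measure)
qed

text \<open>Any \<open>\<kappa> > 1\<close> absorbs the linear term of (t + 1)^2/2 and the constant
  of the density, so the crude bound by the density at \<open>t + 1\<close> is enough.\<close>

lemma std_normal_tail_lower_bound:
  assumes "\<kappa> > (1::real)"
  shows "\<forall>\<^sub>F t in at_top. exp (- \<kappa> * t\<^sup>2 / 2) < measure std_normal_distribution {t<..}"
proof -
  have "\<forall>\<^sub>F t in at_top. exp (- \<kappa> * t\<^sup>2 / 2) < std_normal_density (t + 1)"
    unfolding std_normal_density_def using assms by real_asymp
  then show ?thesis
    using eventually_ge_at_top[of 0]
    by eventually_elim (use std_normal_tail_ge in \<open>force intro: less_le_trans\<close>)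
qed

context iid_family begin

text \<open>The central limit theorem is used along one injective sequence in \<open>I\<close>;
  since the law of a sum depends only on the number of terms, the threshold \<open>q0\<close> serves
  all index sets at once.\<close>

lemma clt_tail:
  assumes inf: "infinite I"
    and int1: "integrable \<mu> (\<lambda>x. x)" "(\<integral>x. x \<partial>\<mu>) = 0"
    and int2: "integrable \<mu> (\<lambda>x. x\<^sup>2)" "(\<integral>x. x\<^sup>2 \<partial>\<mu>) = v" and v: "v > 0"
    and c: "c < measure std_normal_distribution {t<..}"
  shows "\<exists>q0. \<forall>J. J \<subseteq> I \<longrightarrow> card J \<ge> q0 \<longrightarrow> c \<le> \<P>(\<omega> in M. (\<Sum>k\<in>J. X k \<omega>) > t * sqrt (real (card J) * v))"
proof -
  obtain f :: "nat \<Rightarrow> 'i" where f: "inj f" "range f \<subseteq> I"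
    using infinite_countable_subset[OF inf] by blast
  have fI: "f n \<in> I" for n using f by auto
  have "indep_vars (\<lambda>_. borel) (\<lambda>n \<omega>. \<Sum>k\<in>{f n}. X k \<omega>) UNIV"
    using f by (intro indep_sums) (auto simp: disjoint_family_on_def inj_def)
  then have ind: "indep_vars (\<lambda>_. borel) (\<lambda>n. X (f n)) UNIV" by simp
  have E1: "expectation (X (f n)) = 0" for n
    using expectation_family[of "\<lambda>x. x" "f n"] fI int1(2) by simp
  have E2: "integrable M (\<lambda>\<omega>. (X (f n) \<omega>)\<^sup>2)" "expectation (\<lambda>\<omega>. (X (f n) \<omega>)\<^sup>2) = v" for n
    using integrable_family[OF int2(1), of "f n"] expectation_family[of "\<lambda>x. x\<^sup>2" "f n"] fI int2(2) by simp_all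
  have clt: "weak_conv_m (\<lambda>n. distr M borel (\<lambda>x. (\<Sum>i<n. X (f i) x) / sqrt (real n * (sqrt v)\<^sup>2))) std_normal_distribution"
    using ind E1 E2 v ident[OF fI] by (intro central_limit_theorem_zero_mean[where \<mu> = \<mu>]) auto
  interpret N: real_distribution std_normal_distribution
    by (rule real_dist_normal_dist)
  \<comment> \<open>Weak convergence gives convergence of distribution functions only at continuity
    points, so the normal law must have no atom at \<open>t\<close>.\<close>
  have sing: "measure std_normal_distribution {t} = 0"
  proof -
    have "AE x in lborel. ennreal (std_normal_density x) * indicator {t} x = 0"
      using AE_lborel_singleton[of t] by eventually_elim simp
    then have "emeasure std_normal_distribution {t} = 0"
      by (subst emeasure_density) (auto simp: nn_integral_0_iff_AE)
    then show ?thesis by (simp add: measure_def)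
  qed
  let ?D = "\<lambda>n. distr M borel (\<lambda>x. (\<Sum>i<n. X (f i) x) / sqrt (real n * v))"
  have lim: "(\<lambda>n. cdf (?D n) t) \<longlonglongrightarrow> cdf std_normal_distribution t"
    using clt v sing N.isCont_cdf[of t] by (simp add: weak_conv_m_def weak_conv_def)
  have "cdf std_normal_distribution t < 1 - c"
  proof -
    have "measure std_normal_distribution {t<..} = 1 - cdf std_normal_distribution t"
    proof -
      have "{t<..} = space std_normal_distribution - {..t}" by auto
      also have "measure std_normal_distribution \<dots> = 1 - measure std_normal_distribution {..t}"
        by (rule N.prob_compl) simp
      finally show ?thesis unfolding cdf_def .
    qed
    with c show ?thesis by simp
  qed
  with order_tendstoD(2)[OF lim] have "\<forall>\<^sub>F n in sequentially. cdf (?D n) t < 1 - c" by blast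
  then obtain q1 where q1: "\<And>n. n \<ge> q1 \<Longrightarrow> cdf (?D n) t < 1 - c"
    by (auto simp: eventually_sequentially)
  show ?thesis
  \<comment> \<open>The 1 excludes the empty sum, for which the normaliser sqrt(n*v)
    vanishes.\<close>
  proof (intro exI[of _ "max q1 1"] allI impI)
    fix J assume J: "J \<subseteq> I" "card J \<ge> max q1 1"
    define n where "n = card J"
    have n: "n \<ge> q1" "n > 0" using J by (auto simp: n_def)
    have [measurable]: "X (f i) \<in> borel_measurable M" for i using rv fI by auto
    have "c < 1 - cdf (?D n) t" using q1[OF n(1)] by simp
    also have "cdf (?D n) t = \<P>(\<omega> in M. (\<Sum>i<n. X (f i) \<omega>) / sqrt (real n * v) \<le> t)"
      unfolding cdf_def by (subst measure_distr) (auto intro!: arg_cong[where f=prob])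
    also have "1 - \<dots> = \<P>(\<omega> in M. \<not> (\<Sum>i<n. X (f i) \<omega>) / sqrt (real n * v) \<le> t)"
      by (intro prob_neg[symmetric]) measurable
    also have "\<dots> = \<P>(\<omega> in M. (\<Sum>i<n. X (f i) \<omega>) > t * sqrt (real n * v))"
      using n v by (intro arg_cong[where f=prob] Collect_cong) (auto simp: field_simps not_le)
    also have "\<dots> = \<P>(\<omega> in M. (\<Sum>k\<in>f ` {..<n}. X k \<omega>) > t * sqrt (real n * v))"
      using f(1) by (simp add: sum.reindex inj_on_def inj_def)
    also have "\<dots> = \<P>(\<omega> in M. (\<Sum>k\<in>J. X k \<omega>) > t * sqrt (real n * v))"
      using f J(1) by (intro prob_sum_gt_cong) (auto simp: n_def card_image inj_on_def inj_def)
    finally show "c \<le> \<P>(\<omega> in M. (\<Sum>k\<in>J. X k \<omega>) > t * sqrt (real (card J) * v))"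
      by (simp add: n_def)
  qed
qed

text \<open>Pieces of exactly \<open>q\<close> indices are split off one by one and
  \<open>prob_sum_gt_union\<close> multiplies the bounds; the last piece keeps all the remaining
  indices, which is why \<open>piece\<close> covers sets with more than \<open>q\<close>
  elements.\<close>

lemma prob_sum_gt_pieces:
  assumes c: "0 \<le> c"
    and piece: "\<And>J. J \<subseteq> I \<Longrightarrow> finite J \<Longrightarrow> card J \<ge> q \<Longrightarrow> c \<le> \<P>(\<omega> in M. (\<Sum>k\<in>J. X k \<omega>) > y)"
    and J: "J \<subseteq> I" "finite J" "card J \<ge> Suc r * q"
  shows "c ^ Suc r \<le> \<P>(\<omega> in M. (\<Sum>k\<in>J. X k \<omega>) > real (Suc r) * y)"
  using J
proof (induction r arbitrary: J)
  case 0
  then show ?case using piece by simp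
next
  case (Suc r)
  then have "q \<le> card J" by simp
  then obtain A where A: "A \<subseteq> J" "card A = q" "finite A"
    by (rule obtain_subset_with_card_n)
  have cB: "card (J - A) \<ge> Suc r * q"
    using Suc.prems A by (simp add: card_Diff_subset)
  have "c ^ Suc (Suc r) = c * c ^ Suc r" by simp
  also have "\<dots> \<le> \<P>(\<omega> in M. (\<Sum>k\<in>A. X k \<omega>) > y) * \<P>(\<omega> in M. (\<Sum>k\<in>J - A. X k \<omega>) > real (Suc r) * y)"
    using Suc.prems A cB c by (intro mult_mono piece Suc.IH) auto
  also have "\<dots> \<le> \<P>(\<omega> in M. (\<Sum>k\<in>A \<union> (J - A). X k \<omega>) > y + real (Suc r) * y)"
    using Suc.prems A by (intro prob_sum_gt_union) auto
  also have "A \<union> (J - A) = J" using A by auto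
  also have "y + real (Suc r) * y = real (Suc (Suc r)) * y" by (simp add: algebra_simps)
  finally show ?case .
qed

text \<open>With m = \<open>card (J i)\<close>, the set \<open>J i\<close> is cut into r pieces of
  at least q = m div r indices, r about 2*a*ln i/t^2 with s^2/v < a < 1. If each piece exceeds
  t*sqrt(q*v), the total exceeds r*t*sqrt(q*v), about sqrt(2*a*v*m*ln i), which lies above the
  required level since a*v > s^2. This has probability at least exp(-\<kappa>*t^2*r/2), which is at
  least a constant times 1/i since \<kappa>*a = 1.\<close>

lemma not_summable_prob_sum_gt:
  fixes J :: "nat \<Rightarrow> 'i set"
  assumes J: "\<And>i. J i \<subseteq> I" "\<And>i. finite (J i)"
    and int1: "integrable \<mu> (\<lambda>x. x)" "(\<integral>x. x \<partial>\<mu>) = 0"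
    and int2: "integrable \<mu> (\<lambda>x. x\<^sup>2)" "(\<integral>x. x\<^sup>2 \<partial>\<mu>) = v"
    and growth: "c > 0" "\<gamma> > 0" "\<forall>\<^sub>F i in sequentially. c * real i powr \<gamma> \<le> real (card (J i))"
    and s: "s > 0" "s\<^sup>2 < v"
  shows "\<not> summable (\<lambda>i. \<P>(\<omega> in M. (\<Sum>k\<in>J i. X k \<omega>) > s * sqrt (2 * real (card (J i)) * ln (real i))))"
proof
  let ?P = "\<lambda>i. \<P>(\<omega> in M. (\<Sum>k\<in>J i. X k \<omega>) > s * sqrt (2 * real (card (J i)) * ln (real i)))"
  assume summ: "summable ?P"
  have v: "v > 0" using s by (smt (verit) zero_le_power2)
  have inf: "infinite I"
  proof
    assume fin: "finite I"
    have "\<forall>\<^sub>F i::nat in sequentially. real (card I) < c * real i powr \<gamma>"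
      using growth by real_asymp
    with growth(3) have "\<forall>\<^sub>F i::nat in sequentially. False"
      by eventually_elim (use card_mono[OF fin J(1)] in \<open>smt (verit) of_nat_le_iff\<close>)
    then show False by simp
  qed
  obtain a where a: "s\<^sup>2 / v < a" "a < 1"
    using dense[of "s\<^sup>2 / v" 1] s v by auto
  have a0: "a > 0" using a s v by (smt (verit) divide_pos_pos zero_less_power)
  have av: "a * v > s\<^sup>2" using a v by (simp add: field_simps)
  define \<kappa> where "\<kappa> = 1 / a"
  have "\<kappa> > 1" using a a0 by (simp add: \<kappa>_def)
  then have "\<forall>\<^sub>F t in at_top. exp (- \<kappa> * t\<^sup>2 / 2) < measure std_normal_distribution {t<..} \<and> t > 0"
    by (intro eventually_conj std_normal_tail_lower_bound eventually_gt_at_top)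
  then obtain t where t: "exp (- \<kappa> * t\<^sup>2 / 2) < measure std_normal_distribution {t<..}" "t > 0"
    using eventually_happens'[OF trivial_limit_at_top_linorder] by blast
  let ?e = "exp (- \<kappa> * t\<^sup>2 / 2)"
  obtain q0 where q0: "\<And>J. J \<subseteq> I \<Longrightarrow> card J \<ge> q0 \<Longrightarrow> ?e \<le> \<P>(\<omega> in M. (\<Sum>k\<in>J. X k \<omega>) > t * sqrt (real (card J) * v))"
    using clt_tail[OF inf int1 int2 v t(1)] by blast
  \<comment> \<open>\<open>R i\<close> solves exp(-\<kappa>*t^2*R/2) = 1/i; rounding it up to
    \<open>r\<close> costs at most one factor \<open>?e\<close>.\<close>
  define R where "R i = 2 * a * ln (real i) / t\<^sup>2" for i :: nat
  \<comment> \<open>Having at least \<open>D * r\<close> indices does two things: each piece gets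
    \<open>q0\<close> or more, as the central limit theorem demands, and the at most
    \<open>r\<close> indices lost in the division \<open>m div r\<close> stay within the slack
    between s^2 and a*v.\<close>
  define D where "D = max (real q0) (a * v / (a * v - s\<^sup>2))"
  have D0: "D > 0" using av a0 v by (auto simp: D_def less_max_iff_disj)
  \<comment> \<open>The left side is logarithmic in \<open>i\<close>, the right side a positive
    power.\<close>
  have "\<forall>\<^sub>F i in sequentially. D * (R i + 1) \<le> c * real i powr \<gamma>"
    unfolding R_def using growth(1,2) D0 a0 t(2) by real_asymp
  then have "\<forall>\<^sub>F i in sequentially. norm (?e * (1 / real i)) \<le> ?P i"
    using growth(3) eventually_ge_at_top[of 3]
  proof eventually_elim
    case (elim i)
    define m where "m = card (J i)"
    define L where "L = ln (real i)"
    have L: "L > 0" using elim by (simp add: L_def)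
    have Rpos: "R i > 0" using L a0 t by (simp add: R_def L_def)
    define r where "r = nat \<lceil>R i\<rceil>"
    have r: "R i \<le> real r" "real r \<le> R i + 1" "r > 0" using Rpos unfolding r_def by linarith+
    define q where "q = m div r"
    have D: "D \<ge> real q0" "D \<ge> a * v / (a * v - s\<^sup>2)" by (auto simp: D_def)
    have Dr: "D * real r \<le> real m"
    proof -
      have "D * real r \<le> D * (R i + 1)" using r(2) D0 by (intro mult_left_mono) auto
      also note elim(1)
      also note elim(2)
      finally show ?thesis by (simp add: m_def)
    qed
    have "real q0 * real r \<le> real m"
      using mult_right_mono[OF D(1), of "real r"] Dr by simp
    then have "q0 * r \<le> m" by (metis of_nat_le_iff of_nat_mult)
    then have qq0: "q \<ge> q0" using r(3) by (simp add: q_def less_eq_div_iff_mult_less_eq)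
    have rq: "r * q \<le> m" by (simp add: q_def)
    have "m < r * q + r" using r(3)
      by (metis q_def add.commute div_mult_mod_eq mod_less_divisor mult.commute nat_add_left_cancel_less)
    then have rq2: "real m - real r \<le> real r * real q"
      by (metis (mono_tags) diff_le_eq less_imp_le of_nat_add of_nat_le_iff of_nat_mult)
    have "a * v / (a * v - s\<^sup>2) * real r \<le> real m"
      using mult_right_mono[OF D(2), of "real r"] Dr by simp
    then have key: "s\<^sup>2 * real m \<le> a * v * (real m - real r)"
      using av by (simp add: field_simps)
    define y where "y = t * sqrt (real q * v)"
    have thr: "s * sqrt (2 * real m * L) \<le> real r * y"
    proof (rule power2_le_imp_le)
      have "(s * sqrt (2 * real m * L))\<^sup>2 = 2 * L * (s\<^sup>2 * real m)"
        using L by (simp add: power_mult_distrib)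
      also have "\<dots> \<le> 2 * L * (a * v * (real m - real r))"
        using key L by (intro mult_left_mono) auto
      also have "\<dots> \<le> 2 * L * (a * v * (real r * real q))"
        using rq2 L a0 v by (intro mult_left_mono) auto
      also have "\<dots> = (R i * t\<^sup>2) * (v * (real r * real q))"
        using t by (simp add: R_def L_def)
      also have "\<dots> \<le> (real r * t\<^sup>2) * (v * (real r * real q))"
        using r(1) v by (intro mult_right_mono) auto
      also have "\<dots> = (real r * y)\<^sup>2"
        using v by (simp add: y_def power_mult_distrib power2_eq_square)
      finally show "(s * sqrt (2 * real m * L))\<^sup>2 \<le> (real r * y)\<^sup>2" .
      show "0 \<le> real r * y" using t v by (simp add: y_def)
    qed
    obtain r' where r': "r = Suc r'" using r(3) gr0_implies_Suc by blast
    have "?e * (1 / real i) \<le> ?e ^ r"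
    proof -
      have "\<kappa> * t\<^sup>2 / 2 * real r \<le> \<kappa> * t\<^sup>2 / 2 * (R i + 1)"
        using r(2) a0 by (intro mult_left_mono) (auto simp: \<kappa>_def)
      also have "\<dots> = L + \<kappa> * t\<^sup>2 / 2"
        using t a0 by (simp add: R_def L_def \<kappa>_def field_simps)
      finally have "exp (- (L + \<kappa> * t\<^sup>2 / 2)) \<le> exp (- (\<kappa> * t\<^sup>2 / 2 * real r))" by simp
      also have "\<dots> = ?e ^ r" by (simp add: exp_of_nat_mult[symmetric] mult_ac)
      also have "exp (- (L + \<kappa> * t\<^sup>2 / 2)) = ?e * (1 / real i)"
      proof -
        have "exp (- (L + \<kappa> * t\<^sup>2 / 2)) = exp (- L) * ?e" by (simp add: exp_add[symmetric])
        also have "exp (- L) = 1 / real i" using elim by (simp add: L_def exp_minus inverse_eq_divide)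
        finally show ?thesis by simp
      qed
      finally show ?thesis .
    qed
    also have "?e ^ r \<le> \<P>(\<omega> in M. (\<Sum>k\<in>J i. X k \<omega>) > real r * y)"
      unfolding r'
    proof (rule prob_sum_gt_pieces)
      fix B assume B: "B \<subseteq> I" "finite B" "card B \<ge> q"
      have "?e \<le> \<P>(\<omega> in M. (\<Sum>k\<in>B. X k \<omega>) > t * sqrt (real (card B) * v))"
        using B qq0 by (intro q0) auto
      also have "\<dots> \<le> \<P>(\<omega> in M. (\<Sum>k\<in>B. X k \<omega>) > y)"
      proof -
        have "y \<le> t * sqrt (real (card B) * v)"
          unfolding y_def using B t v by (intro mult_left_mono) auto
        then show ?thesis using B by (intro finite_measure_mono event_sum_gt) auto
      qed
      finally show "?e \<le> \<P>(\<omega> in M. (\<Sum>k\<in>B. X k \<omega>) > y)" .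
    qed (use J rq r' in \<open>auto simp: m_def\<close>)
    also have "\<dots> \<le> ?P i"
      using thr J by (intro finite_measure_mono event_sum_gt) (auto simp: m_def L_def)
    finally show ?case by simp
  qed
  from summable_comparison_test_ev[OF this summ] have "summable (\<lambda>i. 1 / real i)"
    by (subst (asm) summable_cmult_iff) auto
  then show False
    using not_summable_harmonic[where 'a = real] summable_Suc_iff[of "\<lambda>i. 1 / real i"]
    by (simp add: inverse_eq_divide)
qed

end

section \<open>Almost sure limsup and liminf of the normalised sums\<close>

lemma limsup_ge_of_frequently:
  fixes f :: "nat \<Rightarrow> ereal"
  assumes "\<exists>\<^sub>F i in sequentially. f i \<ge> c"
  shows "limsup f \<ge> c"
proof (rule ccontr)
  assume "\<not> limsup f \<ge> c"
  then have "\<forall>\<^sub>F i in sequentially. f i < c" by (intro Limsup_lessD) simp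
  with assms show False by (simp add: frequently_def not_le)
qed

context iid_family begin

text \<open>Normalising by the number of terms and ln i makes the limits plus and minus sqrt(v) for
  every growth exponent; the comparison with the normaliser of the theorem is postponed to the
  end.\<close>

abbreviation normalised_sum :: "(nat \<Rightarrow> 'i set) \<Rightarrow> 'a \<Rightarrow> nat \<Rightarrow> ereal" where
  "normalised_sum J \<omega> \<equiv> (\<lambda>i. ereal ((\<Sum>k\<in>J i. X k \<omega>) / sqrt (2 * real (card (J i)) * ln (real i))))"

lemma limsup_normalised_sums_le:
  fixes J :: "nat \<Rightarrow> 'i set"
  assumes J: "\<And>i. J i \<subseteq> I" "\<And>i. finite (J i)"
    and int1: "integrable \<mu> (\<lambda>x. x)" "(\<integral>x. x \<partial>\<mu>) = 0"
    and int2: "integrable \<mu> (\<lambda>x. x\<^sup>2)" "(\<integral>x. x\<^sup>2 \<partial>\<mu>) = v"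
    and intp: "integrable \<mu> (\<lambda>x. \<bar>x\<bar> powr p)"
    and growth: "c > 0" "\<forall>\<^sub>F i in sequentially. c * real i powr \<gamma> \<le> real (card (J i))"
    and p: "p > 2" "\<gamma> * (p / 2 - 1) > 1"
  shows "AE \<omega> in M. limsup (normalised_sum J \<omega>) \<le> ereal (sqrt v)"
proof -
  have v0: "v \<ge> 0" unfolding int2(2)[symmetric] by simp
  \<comment> \<open>Levels decreasing to sqrt(v): countably many null sets suffice, and the square
    of each level lies above \<open>v\<close>, also when \<open>v = 0\<close>.\<close>
  define s where "s n = sqrt v + 1 / real (Suc n)" for n
  have s: "s n > 0" "v < (s n)\<^sup>2" for n
  proof -
    show "s n > 0" using v0 by (simp add: s_def add_nonneg_pos)
    have "(sqrt v)\<^sup>2 < (s n)\<^sup>2" using v0 by (intro power_strict_mono) (auto simp: s_def)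
    then show "v < (s n)\<^sup>2" using v0 by simp
  qed
  have "AE \<omega> in M. \<forall>n. limsup (normalised_sum J \<omega>) \<le> ereal (s n)"
    unfolding AE_all_countable
  proof
    fix n
    have "AE \<omega> in M. \<forall>\<^sub>F i in sequentially. \<omega> \<in> space M - {\<omega> \<in> space M. (\<Sum>k\<in>J i. X k \<omega>) > s n * sqrt (2 * real (card (J i)) * ln (real i))}"
      by (rule borel_cantelli_AE1)
        (use event_sum_gt[OF J(1)] summable_prob_sum_gt[OF J int1 int2 intp growth p s, of n]
          in \<open>auto simp: emeasure_eq_measure\<close>)
    then show "AE \<omega> in M. limsup (normalised_sum J \<omega>) \<le> ereal (s n)"
    proof (rule AE_mp, intro AE_I2 impI)
      fix \<omega> assume "\<forall>\<^sub>F i in sequentially. \<omega> \<in> space M - {\<omega> \<in> space M. (\<Sum>k\<in>J i. X k \<omega>) > s n * sqrt (2 * real (card (J i)) * ln (real i))}"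
      then have "\<forall>\<^sub>F i in sequentially. ereal ((\<Sum>k\<in>J i. X k \<omega>) / sqrt (2 * real (card (J i)) * ln (real i))) \<le> ereal (s n)"
        using eventually_ge_at_top[of 1]
      proof eventually_elim
        case (elim i)
        let ?q = "sqrt (2 * real (card (J i)) * ln (real i))"
        have "?q \<ge> 0" using elim by simp
        \<comment> \<open>If the normaliser vanishes, the quotient is 0 by convention, and 0 lies
          below the positive level.\<close>
        with elim s(1)[of n] show ?case
          by (cases "?q = 0") (auto simp: divide_le_eq not_less less_imp_le)
      qed
      then show "limsup (normalised_sum J \<omega>) \<le> ereal (s n)"
        by (rule Limsup_bounded)
    qed
  qed
  then show ?thesis
  proof (rule AE_mp, intro AE_I2 impI)
    fix \<omega> assume *: "\<forall>n. limsup (normalised_sum J \<omega>) \<le> ereal (s n)"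
    have "(\<lambda>n. 1 / real (Suc n)) \<longlonglongrightarrow> 0" by real_asymp
    from tendsto_add[OF tendsto_const this, of "sqrt v"] have "s \<longlonglongrightarrow> sqrt v" unfolding s_def by simp
    then have "(\<lambda>n. ereal (s n)) \<longlonglongrightarrow> ereal (sqrt v)" by simp
    then show "limsup (normalised_sum J \<omega>) \<le> ereal (sqrt v)"
      by (rule LIMSEQ_le_const) (use * in auto)
  qed
qed

lemma limsup_normalised_sums_ge:
  fixes J :: "nat \<Rightarrow> 'i set"
  assumes J: "\<And>i. J i \<subseteq> I" "\<And>i. finite (J i)" and disj: "disjoint_family_on J {n0..}"
    and int1: "integrable \<mu> (\<lambda>x. x)" "(\<integral>x. x \<partial>\<mu>) = 0"
    and int2: "integrable \<mu> (\<lambda>x. x\<^sup>2)" "(\<integral>x. x\<^sup>2 \<partial>\<mu>) = v" and v: "v > 0"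
    and growth: "c > 0" "\<gamma> > 0" "\<forall>\<^sub>F i in sequentially. c * real i powr \<gamma> \<le> real (card (J i))"
  shows "AE \<omega> in M. limsup (normalised_sum J \<omega>) \<ge> ereal (sqrt v)"
proof -
  \<comment> \<open>Levels increasing to sqrt(v); the shift by 2 keeps the level at n = 0 positive,
    as \<open>not_summable_prob_sum_gt\<close> demands.\<close>
  define s where "s n = sqrt v * (1 - 1 / real (n + 2))" for n
  have s: "s n > 0" "(s n)\<^sup>2 < v" for n
  proof -
    show s0: "s n > 0" using v by (simp add: s_def)
    have "(s n)\<^sup>2 < (sqrt v)\<^sup>2" using v s0
      by (intro power_strict_mono) (auto simp: s_def mult_less_cancel_left2)
    then show "(s n)\<^sup>2 < v" using v by simp
  qed
  have ind: "indep_vars (\<lambda>_. borel) (\<lambda>i \<omega>. \<Sum>k\<in>J i. X k \<omega>) {n0..}"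
    using J disj by (intro indep_sums) auto
  \<comment> \<open>For a lower bound a vanishing normaliser would be fatal, since the quotient
    would be 0.\<close>
  have gp: "\<forall>\<^sub>F i in sequentially. 2 * real (card (J i)) * ln (real i) > 0"
    using growth(3) eventually_ge_at_top[of 3]
  proof eventually_elim
    case (elim i)
    have "0 < c * real i powr \<gamma>" using growth(1) elim by simp
    with elim have "0 < real (card (J i))" by linarith
    with elim show ?case by simp
  qed
  have "AE \<omega> in M. \<forall>n. limsup (normalised_sum J \<omega>) \<ge> ereal (s n)"
    unfolding AE_all_countable
  proof
    fix n
    have "AE \<omega> in M. \<exists>\<^sub>F i in sequentially. (\<Sum>k\<in>J i. X k \<omega>) \<in> {s n * sqrt (2 * real (card (J i)) * ln (real i))<..}"
      using not_summable_prob_sum_gt[OF J int1 int2 growth s, of n]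
      by (intro borel_cantelli_AE2[OF ind]) (auto simp: vimage_def Int_def conj_commute)
    then show "AE \<omega> in M. limsup (normalised_sum J \<omega>) \<ge> ereal (s n)"
    proof (rule AE_mp, intro AE_I2 impI limsup_ge_of_frequently)
      fix \<omega> assume "\<exists>\<^sub>F i in sequentially. (\<Sum>k\<in>J i. X k \<omega>) \<in> {s n * sqrt (2 * real (card (J i)) * ln (real i))<..}"
      with gp have "\<exists>\<^sub>F i in sequentially. (\<Sum>k\<in>J i. X k \<omega>) \<in> {s n * sqrt (2 * real (card (J i)) * ln (real i))<..} \<and> 2 * real (card (J i)) * ln (real i) > 0"
        by (rule frequently_eventually_frequently[rotated])
      then show "\<exists>\<^sub>F i in sequentially. ereal (s n) \<le> ereal ((\<Sum>k\<in>J i. X k \<omega>) / sqrt (2 * real (card (J i)) * ln (real i)))"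
      proof (rule frequently_mono[rotated], intro allI impI)
        fix i assume i: "(\<Sum>k\<in>J i. X k \<omega>) \<in> {s n * sqrt (2 * real (card (J i)) * ln (real i))<..} \<and> 2 * real (card (J i)) * ln (real i) > 0"
        then have "sqrt (2 * real (card (J i)) * ln (real i)) > 0" by (subst real_sqrt_gt_0_iff) blast
        with i show "ereal (s n) \<le> ereal ((\<Sum>k\<in>J i. X k \<omega>) / sqrt (2 * real (card (J i)) * ln (real i)))"
          by (simp only: ereal_less_eq pos_le_divide_eq) auto
      qed
    qed
  qed
  then show ?thesis
  proof (rule AE_mp, intro AE_I2 impI)
    fix \<omega> assume *: "\<forall>n. limsup (normalised_sum J \<omega>) \<ge> ereal (s n)"
    have "(\<lambda>n. 1 - 1 / real (n + 2)) \<longlonglongrightarrow> 1" by real_asymp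
    from tendsto_mult_left[OF this, of "sqrt v"] have "s \<longlonglongrightarrow> sqrt v" unfolding s_def by simp
    then have "(\<lambda>n. ereal (s n)) \<longlonglongrightarrow> ereal (sqrt v)" by simp
    then show "limsup (normalised_sum J \<omega>) \<ge> ereal (sqrt v)"
      by (rule LIMSEQ_le_const2) (use * in auto)
  qed
qed

text \<open>The liminf is minus the limsup of the negated sums, so both bounds on it come from
  entering the locale with the negated variables.\<close>

lemma iid_family_uminus: "iid_family M (\<lambda>k \<omega>. - X k \<omega>) I (distr \<mu> borel uminus)"
proof unfold_locales
  show "indep_vars (\<lambda>_. borel) (\<lambda>k \<omega>. - X k \<omega>) I"
    by (rule indep_vars_compose2[OF indep]) simp
  show "distr M borel (\<lambda>\<omega>. - X k \<omega>) = distr \<mu> borel uminus" if "k \<in> I" for k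
    using rv[OF that] ident[OF that, symmetric] by (simp add: distr_distr comp_def)
qed

theorem limsup_liminf_normalised_sums:
  fixes J :: "nat \<Rightarrow> 'i set"
  assumes J: "\<And>i. J i \<subseteq> I" "\<And>i. finite (J i)" and disj: "disjoint_family_on J {n0..}"
    and \<mu>: "sets \<mu> = sets borel"
    and int1: "integrable \<mu> (\<lambda>x. x)" "(\<integral>x. x \<partial>\<mu>) = 0"
    and int2: "integrable \<mu> (\<lambda>x. x\<^sup>2)" "(\<integral>x. x\<^sup>2 \<partial>\<mu>) = v"
    and intp: "integrable \<mu> (\<lambda>x. \<bar>x\<bar> powr p)"
    and growth: "c > 0" "\<gamma> > 0" "\<forall>\<^sub>F i in sequentially. c * real i powr \<gamma> \<le> real (card (J i))"
    and p: "p > 2" "\<gamma> * (p / 2 - 1) > 1"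
  shows "AE \<omega> in M.
     limsup (normalised_sum J \<omega>) = ereal (sqrt v) \<and>
     liminf (normalised_sum J \<omega>) = - ereal (sqrt v)"
proof -
  interpret neg: iid_family M "\<lambda>k \<omega>. - X k \<omega>" I "distr \<mu> borel uminus" by (rule iid_family_uminus)
  have um: "(uminus :: real \<Rightarrow> real) \<in> measurable \<mu> borel"
    unfolding measurable_cong_sets[OF \<mu> refl] by simp
  have D: "integrable (distr \<mu> borel uminus) f \<longleftrightarrow> integrable \<mu> (\<lambda>x. f (- x))"
    "integral\<^sup>L (distr \<mu> borel uminus) f = (\<integral>x. f (- x) \<partial>\<mu>)"
    if "f \<in> borel_measurable borel" for f :: "real \<Rightarrow> real"
    using integrable_distr_eq[OF um that] integral_distr[OF um that] by auto
  have int1': "integrable (distr \<mu> borel uminus) (\<lambda>x::real. x)" "(\<integral>x. x \<partial>distr \<mu> borel uminus) = (0::real)"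
    by (rule iffD2[OF D(1)], simp, rule Bochner_Integration.integrable_minus, rule int1(1))
       (rule trans[OF D(2)], simp, subst Bochner_Integration.integral_minus, simp add: int1(2))
  have int2': "integrable (distr \<mu> borel uminus) (\<lambda>x::real. x\<^sup>2)" "(\<integral>x. x\<^sup>2 \<partial>distr \<mu> borel uminus) = v"
    using int2 by (subst D; simp)+
  have intp': "integrable (distr \<mu> borel uminus) (\<lambda>x::real. \<bar>x\<bar> powr p)"
    using intp by (subst D; simp)
  let ?Z = "normalised_sum J"
  have mZ: "ereal ((\<Sum>k\<in>J i. - X k \<omega>) / sqrt (2 * real (card (J i)) * ln (real i))) = - ?Z \<omega> i" for i \<omega>
    by (simp add: sum_negf)
  have lim_uminus: "limsup (neg.normalised_sum J \<omega>) = - liminf (?Z \<omega>)" for \<omega>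
    unfolding mZ by (rule ereal_Limsup_uminus)
  have v0: "v \<ge> 0" unfolding int2(2)[symmetric] by simp
  have U: "AE \<omega> in M. limsup (?Z \<omega>) \<le> ereal (sqrt v)"
    by (rule limsup_normalised_sums_le[OF J int1 int2 intp growth(1,3) p])
  have U': "AE \<omega> in M. liminf (?Z \<omega>) \<ge> - ereal (sqrt v)"
    using neg.limsup_normalised_sums_le[OF J int1' int2' intp' growth(1,3) p]
    unfolding lim_uminus by eventually_elim (metis ereal_minus_le_minus ereal_uminus_uminus)
  have le: "liminf (?Z \<omega>) \<le> limsup (?Z \<omega>)" for \<omega> by (intro Liminf_le_Limsup) simp
  show ?thesis
  \<comment> \<open>The lower bound for the limsup needs \<open>v > 0\<close>; for
    \<open>v = 0\<close> the bounds \<open>U\<close> and \<open>U'\<close> already give 0 <= liminf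
    <= limsup <= 0.\<close>
  proof (cases "v = 0")
    case True
    then have s0: "ereal (sqrt v) = 0" by simp
    show ?thesis using U U'
    proof eventually_elim
      case (elim \<omega>)
      then show ?case using le[of \<omega>] unfolding s0 by auto
    qed
  next
    case False
    with v0 have v: "v > 0" by simp
    have L: "AE \<omega> in M. limsup (?Z \<omega>) \<ge> ereal (sqrt v)"
      by (rule limsup_normalised_sums_ge[OF J disj int1 int2 v growth])
    have L': "AE \<omega> in M. liminf (?Z \<omega>) \<le> - ereal (sqrt v)"
      using neg.limsup_normalised_sums_ge[OF J disj int1' int2' v growth]
      unfolding lim_uminus by eventually_elim (metis ereal_minus_le_minus ereal_uminus_uminus)
    show ?thesis using U U' L L' by eventually_elim auto
  qed
qed

end

section \<open>Floors, moments and cubes\<close>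

text \<open>The floor loses less than 1, which is negligible relative to \<open>f i\<close>. This
  serves for both the position and the side of a cube.\<close>

lemma tendsto_nat_floor_div:
  fixes f :: "nat \<Rightarrow> real"
  assumes "filterlim f at_top sequentially"
  shows "(\<lambda>i. real (nat \<lfloor>f i\<rfloor>) / f i) \<longlonglongrightarrow> 1"
proof (rule tendsto_sandwich)
  have "((\<lambda>x::real. 1 - 1 / x) \<longlongrightarrow> 1) at_top" by real_asymp
  from filterlim_compose[OF this assms] show "(\<lambda>i. 1 - 1 / f i) \<longlonglongrightarrow> 1" .
  have pos: "\<forall>\<^sub>F i in sequentially. f i > 0"
    using assms by (simp add: filterlim_at_top_dense)
  show "\<forall>\<^sub>F i in sequentially. 1 - 1 / f i \<le> real (nat \<lfloor>f i\<rfloor>) / f i"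
    using pos
  proof eventually_elim
    case (elim i)
    have "f i - 1 \<le> real (nat \<lfloor>f i\<rfloor>)" by linarith
    from divide_right_mono[OF this, of "f i"] elim show ?case by (simp add: diff_divide_distrib)
  qed
  show "\<forall>\<^sub>F i in sequentially. real (nat \<lfloor>f i\<rfloor>) / f i \<le> 1"
    using pos by eventually_elim (simp add: divide_le_eq)
qed simp

text \<open>Lowering the exponent from \<open>q\<close> to \<open>p\<close> gains a power of x that
  beats any power of the logarithm, whatever the sign of \<open>e\<close>; below the threshold
  \<open>B\<close> the \<open>p\<close>-th power is bounded.\<close>

lemma integrable_abs_powr_of_log_moment:
  fixes X :: "'a \<Rightarrow> real"
  assumes "prob_space M" and X: "X \<in> borel_measurable M" and p: "0 < p" "p < q"
    and int: "integrable M (\<lambda>\<omega>. \<bar>X \<omega>\<bar> powr q * log_plus \<bar>X \<omega>\<bar> powr e)"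
  shows "integrable M (\<lambda>\<omega>. \<bar>X \<omega>\<bar> powr p)"
proof -
  interpret prob_space M by fact
  have "\<forall>\<^sub>F x::real in at_top. x powr p \<le> x powr q * ln x powr e"
  proof -
    have "\<forall>\<^sub>F x::real in at_top. ln x powr (- e) \<le> x powr (q - p)"
      using p by real_asymp
    then show ?thesis
      using eventually_ge_at_top[of 3]
    proof eventually_elim
      case (elim x)
      have l: "ln x > 0" using elim by simp
      have "x powr p = x powr p * (ln x powr (- e) * ln x powr e)"
        using l by (simp add: powr_add[symmetric])
      also have "\<dots> \<le> x powr p * (x powr (q - p) * ln x powr e)"
        using elim by (intro mult_left_mono mult_right_mono) auto
      also have "\<dots> = x powr q * ln x powr e"
        by (simp add: powr_add[symmetric] mult.assoc[symmetric])
      finally show ?case .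
    qed
  qed
  moreover have "\<forall>\<^sub>F x::real in at_top. ln x \<ge> 1" by real_asymp
  ultimately have "\<forall>\<^sub>F x::real in at_top. x powr p \<le> x powr q * log_plus x powr e"
    by eventually_elim (simp add: log_plus_def max_def)
  then obtain B where B: "\<And>x. x \<ge> B \<Longrightarrow> x powr p \<le> x powr q * log_plus x powr e"
    by (auto simp: eventually_at_top_linorder)
  have bound: "\<bar>x\<bar> powr p \<le> (max B 0) powr p + \<bar>x\<bar> powr q * log_plus \<bar>x\<bar> powr e" for x
  proof (cases "\<bar>x\<bar> \<ge> B")
    case True
    from B[OF this] show ?thesis by (simp add: add_increasing)
  next
    case False
    then have "\<bar>x\<bar> powr p \<le> (max B 0) powr p" using p by (intro powr_mono2) auto
    then show ?thesis by (simp add: add_increasing2)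
  qed
  show ?thesis
  proof (rule Bochner_Integration.integrable_bound)
    show "integrable M (\<lambda>\<omega>. (max B 0) powr p + \<bar>X \<omega>\<bar> powr q * log_plus \<bar>X \<omega>\<bar> powr e)"
      using int by simp
    show "(\<lambda>\<omega>. \<bar>X \<omega>\<bar> powr p) \<in> borel_measurable M" using X by measurable
    show "AE \<omega> in M. norm (\<bar>X \<omega>\<bar> powr p) \<le> norm ((max B 0) powr p + \<bar>X \<omega>\<bar> powr q * log_plus \<bar>X \<omega>\<bar> powr e)"
      using bound by (intro AE_I2) (auto intro: order_trans[OF _ abs_ge_self])
  qed
qed

text \<open>Encoded as the lists of fixed length over an interval, so that finiteness and
  cardinality are facts about such lists.\<close>

definition cube :: "nat \<Rightarrow> nat \<Rightarrow> nat \<Rightarrow> nat list set" where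
  "cube d a k = {j. set j \<subseteq> {a<..a + k} \<and> length j = d}"

lemma finite_cube: "finite (cube d a k)"
  unfolding cube_def by (intro finite_lists_length_eq) simp

lemma card_cube: "card (cube d a k) = k ^ d"
  unfolding cube_def by (subst card_lists_length_eq) auto

lemma cube_subset_pos_idx: "cube d a k \<subseteq> pos_idx d"
  by (auto simp: cube_def pos_idx_def)

lemma cube_disjoint:
  assumes "d \<ge> 1" "a + k \<le> b"
  shows "cube d a k \<inter> cube d b l = {}"
proof -
  have False if "j \<in> cube d a k" "j \<in> cube d b l" for j
  proof -
    \<comment> \<open>One coordinate separates the cubes; \<open>d \<ge> 1\<close> guarantees that
      there is a first one.\<close>
    from that assms have "hd j \<in> set j" by (intro hd_in_set) (auto simp: cube_def)
    with that have "hd j \<in> {a<..a + k}" "hd j \<in> {b<..b + l}" unfolding cube_def by auto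
    with assms show False by auto
  qed
  then show ?thesis by blast
qed

lemma block_sum_replicate:
  "block_sum X (replicate d a) (idx_pow \<alpha> (replicate d a)) \<omega>
    = (\<Sum>j\<in>cube d a (nat \<lfloor>real a powr \<alpha>\<rfloor>). X j \<omega>)"
proof -
  have "{j. length j = length (replicate d a) \<and>
      (\<forall>i<length (replicate d a). replicate d a ! i < j ! i \<and>
        j ! i \<le> replicate d a ! i + idx_pow \<alpha> (replicate d a) ! i)}
    = cube d a (nat \<lfloor>real a powr \<alpha>\<rfloor>)"
    by (auto simp: cube_def idx_pow_def set_conv_nth)
  then show ?thesis unfolding block_sum_def by simp
qed

section \<open>The diagonal cubes: growth, disjointness, moments and the change of
  normaliser\<close>

theorem theorem6p2:
  fixes M :: "'a measure" and X :: "nat list \<Rightarrow> 'a \<Rightarrow> real" and X0 :: "'a \<Rightarrow> real"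
    and d :: nat and \<alpha> \<beta> \<sigma> :: real
  assumes "prob_space M"
    and "d \<ge> 1" and "0 < \<alpha>" and "\<alpha> < 1" and "\<beta> > 1"
    and "X0 \<in> borel_measurable M"
    and "prob_space.indep_vars M (\<lambda>_. borel) X (pos_idx d)"
    and "\<And>k. k \<in> pos_idx d \<Longrightarrow> distr M borel (X k) = distr M borel X0"
    and "integrable M X0" and "prob_space.expectation M X0 = 0"
    and "integrable M (\<lambda>\<omega>. (X0 \<omega>)\<^sup>2)"
    and "\<sigma> = sqrt (prob_space.variance M X0)"
    and "integrable M (\<lambda>\<omega>. \<bar>X0 \<omega>\<bar> powr (2 / \<alpha>) *
                              log_plus \<bar>X0 \<omega>\<bar> powr (real d - 1 - 1 / \<alpha>))"
  defines "n \<equiv> \<lambda>i::nat. replicate d (nat \<lfloor>real i powr (\<beta> / (1 - \<alpha>))\<rfloor>)"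
  shows "AE \<omega> in M.
      limsup (\<lambda>i. ereal (block_sum X (n i) (idx_pow \<alpha> (n i)) \<omega> /
          sqrt (2 * real (idx_size (n i)) powr \<alpha> * ln (real (idx_size (n i))))))
        = ereal (\<sigma> * sqrt ((1 - \<alpha>) / (real d * \<beta>)))
    \<and> liminf (\<lambda>i. ereal (block_sum X (n i) (idx_pow \<alpha> (n i)) \<omega> /
          sqrt (2 * real (idx_size (n i)) powr \<alpha> * ln (real (idx_size (n i))))))
        = ereal (- \<sigma> * sqrt ((1 - \<alpha>) / (real d * \<beta>)))"
proof -
  note d = assms(2) and \<alpha> = assms(3,4) and \<beta> = assms(5) and X0 = assms(6)
  define \<mu> where "\<mu> = distr M borel X0"
  interpret prob_space M by fact
  interpret iid_family M X "pos_idx d" \<mu>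
    using assms(7,8) by unfold_locales (auto simp: \<mu>_def)
  \<comment> \<open>The i-th cube starts at coordinate about i^b and has side about i^(b*\<alpha>),
    so it has about i^\<gamma> points.\<close>
  define b where "b = \<beta> / (1 - \<alpha>)"
  define \<gamma> where "\<gamma> = real d * \<alpha> * b"
  define N where "N i = nat \<lfloor>real i powr b\<rfloor>" for i :: nat
  define K where "K i = nat \<lfloor>real (N i) powr \<alpha>\<rfloor>" for i
  define J where "J i = cube d (N i) (K i)" for i
  have b1\<alpha>: "b * (1 - \<alpha>) = \<beta>" using \<alpha> by (simp add: b_def)
  \<comment> \<open>The second inequality is b*(1 - \<alpha>) = \<beta> > 1 rewritten: the side of
    the i-th cube is of smaller order than i^(b - 1), the order of the gap between consecutive
    positions.\<close>
  have b: "b > 1" "b * \<alpha> < b - 1"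
    using b1\<alpha> \<alpha> \<beta> by (simp add: b_def) (use b1\<alpha> \<beta> in \<open>simp add: right_diff_distrib\<close>)
  have \<gamma>: "\<gamma> > 0" using d \<alpha> b by (simp add: \<gamma>_def)
  have n: "n i = replicate d (N i)" for i by (simp add: n_def N_def b_def)

  have N_top: "filterlim (\<lambda>i. real (N i)) at_top sequentially"
    unfolding N_def using b(1) by real_asymp
  have "filterlim (\<lambda>i::nat. real i powr b) at_top sequentially"
    using b(1) by real_asymp
  from tendsto_nat_floor_div[OF this] have N_lim: "(\<lambda>i. real (N i) / real i powr b) \<longlonglongrightarrow> 1"
    by (simp add: N_def)
  have "filterlim (\<lambda>x::real. x powr \<alpha>) at_top at_top" using \<alpha>(1) by real_asymp
  from tendsto_nat_floor_div[OF filterlim_compose[OF this N_top]]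
  have K_lim: "(\<lambda>i. real (K i) / real (N i) powr \<alpha>) \<longlonglongrightarrow> 1" by (simp add: K_def)
  have N_pos: "\<forall>\<^sub>F i in sequentially. real (N i) > 1"
    using N_top unfolding filterlim_at_top_dense by blast

  \<comment> \<open>The quotient of the cardinality by i^\<gamma> tends to 1; the factor 1/2 absorbs
    both floors.\<close>
  have growth: "\<forall>\<^sub>F i in sequentially. 1/2 * real i powr \<gamma> \<le> real (card (J i))"
  proof -
    have "(\<lambda>i. (real (K i) / real (N i) powr \<alpha>) ^ d * (real (N i) / real i powr b) powr (real d * \<alpha>)) \<longlonglongrightarrow> 1 ^ d * 1 powr (real d * \<alpha>)"
      by (intro tendsto_intros N_lim K_lim) auto
    then have "\<forall>\<^sub>F i in sequentially. (real (K i) / real (N i) powr \<alpha>) ^ d * (real (N i) / real i powr b) powr (real d * \<alpha>) > 1/2"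
      by (rule order_tendstoD) simp
    then show ?thesis using N_pos eventually_gt_at_top[of 0]
    proof eventually_elim
      case (elim i)
      have "(real (N i) powr \<alpha>) ^ d = real (N i) powr (real d * \<alpha>)"
        using elim by (simp add: powr_realpow[symmetric] powr_powr mult.commute)
      then have "(real (K i) / real (N i) powr \<alpha>) ^ d * (real (N i) / real i powr b) powr (real d * \<alpha>)
        = real (K i) ^ d / real i powr \<gamma>"
        using elim by (simp add: power_divide powr_divide powr_powr \<gamma>_def mult_ac)
      with elim(1) have "1/2 < real (K i) ^ d / real i powr \<gamma>" by simp
      with elim(3) show ?case by (simp add: J_def card_cube field_simps)
    qed
  qed

  \<comment> \<open>The summand 1 pays for the floor in \<open>N (Suc i)\<close>, and (i + 1)^b
    \<ge> i^b + i^(b - 1) supplies the gap.\<close>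
  have "\<forall>\<^sub>F i::nat in sequentially. real i powr (b * \<alpha>) + 1 \<le> real i powr (b - 1)"
    using b(2) \<alpha> b(1) by real_asymp
  then have "\<forall>\<^sub>F i in sequentially. N i + K i \<le> N (Suc i)"
    using eventually_gt_at_top[of 0]
  proof eventually_elim
    case (elim i)
    have Ni: "real (N i) \<le> real i powr b" by (simp add: N_def)
    have "real (K i) \<le> real (N i) powr \<alpha>" by (simp add: K_def)
    also have "\<dots> \<le> (real i powr b) powr \<alpha>" using Ni \<alpha> by (intro powr_mono2) auto
    finally have "real (N i) + real (K i) \<le> real i powr b + real i powr (b * \<alpha>)"
      using Ni by (simp add: powr_powr)
    also have "\<dots> \<le> real i powr b + real i powr (b - 1) - 1" using elim by simp
    also have "real i powr b + real i powr (b - 1) = (real i + 1) * real i powr (b - 1)"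
      using elim(2) by (simp add: powr_diff field_simps)
    also have "\<dots> \<le> (real i + 1) * (real i + 1) powr (b - 1)"
      using b by (intro mult_left_mono powr_mono2) auto
    also have "\<dots> = real (Suc i) powr b" by (simp add: powr_diff add.commute)
    also have "real (Suc i) powr b - 1 < real (N (Suc i))" unfolding N_def by linarith
    finally show ?case by linarith
  qed
  then obtain n0 where n0: "\<And>i. i \<ge> n0 \<Longrightarrow> N i + K i \<le> N (Suc i)"
    by (auto simp: eventually_sequentially)
  have N_mono: "N i \<le> N j" if "i \<le> j" for i j
    unfolding N_def using that b by (intro nat_mono floor_mono powr_mono2) auto
  have disj: "disjoint_family_on J {n0..}"
  proof -
    have *: "J i \<inter> J j = {}" if "n0 \<le> i" "i < j" for i j
      unfolding J_def using d
    proof (rule cube_disjoint)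
      show "N i + K i \<le> N j" using n0[OF that(1)] N_mono[of "Suc i" j] that(2) by simp
    qed
    show ?thesis unfolding disjoint_family_on_def
    proof (intro ballI impI)
      fix i j assume "i \<in> {n0..}" "j \<in> {n0..}" "i \<noteq> j"
      then show "J i \<inter> J j = {}" using *[of i j] *[of j i] by (cases i j rule: linorder_cases) auto
    qed
  qed

  \<comment> \<open>The interval is nonempty because 2/\<gamma> < 2/\<alpha> - 2 amounts to 1 <
    d*\<beta>. The lower end makes \<gamma>*(p/2 - 1) > 1, the upper end makes the
    \<open>p\<close>-th moment finite.\<close>
  obtain p where p: "2 + 2 / \<gamma> < p" "p < 2 / \<alpha>"
  proof -
    have "1 * 1 < real d * \<beta>" using d \<beta> by (intro mult_le_less_imp_less) auto
    also have "real d * \<beta> = real d * b * (1 - \<alpha>)" using b1\<alpha> by simp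
    finally have "1 / (real d * b) < 1 - \<alpha>"
      using d b by (simp add: divide_less_eq mult.commute)
    then have "2 / \<alpha> * (1 / (real d * b)) < 2 / \<alpha> * (1 - \<alpha>)"
      using \<alpha> by (intro mult_strict_left_mono) auto
    also have "2 / \<alpha> * (1 / (real d * b)) = 2 / \<gamma>"
      by (simp add: \<gamma>_def mult_ac)
    also have "2 / \<alpha> * (1 - \<alpha>) = 2 / \<alpha> - 2"
      using \<alpha> by (simp add: right_diff_distrib)
    finally have "2 + 2 / \<gamma> < 2 / \<alpha>" by simp
    then show ?thesis using dense that by blast
  qed
  have p2: "p > 2" using p(1) \<gamma> by (smt (verit) divide_pos_pos)
  have p\<gamma>: "\<gamma> * (p / 2 - 1) > 1" using p(1) \<gamma> by (simp add: field_simps)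
  have intp: "integrable \<mu> (\<lambda>x. \<bar>x\<bar> powr p)"
    unfolding \<mu>_def
    by (subst integrable_distr_eq[OF X0])
      (use integrable_abs_powr_of_log_moment[OF assms(1) X0 _ p(2) assms(13)] p2 in auto)
  have int1: "integrable \<mu> (\<lambda>x. x)" "(\<integral>x. x \<partial>\<mu>) = 0"
    unfolding \<mu>_def
    by (rule iffD2[OF integrable_distr_eq[OF X0, of "\<lambda>x. x"] assms(9)], simp)
       (rule trans[OF integral_distr[OF X0, of "\<lambda>x. x"] assms(10)], simp)
  have int2: "integrable \<mu> (\<lambda>x. x\<^sup>2)" "(\<integral>x. x\<^sup>2 \<partial>\<mu>) = variance X0"
    unfolding \<mu>_def using assms(10,11) integrable_distr_eq[OF X0, of "\<lambda>x. x\<^sup>2"] integral_distr[OF X0, of "\<lambda>x. x\<^sup>2"] by auto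

  let ?S = "\<lambda>\<omega> i. (\<Sum>k\<in>J i. X k \<omega>)"
  let ?A = "\<lambda>i. 2 * real (card (J i)) * ln (real i)"
  let ?B = "\<lambda>i. 2 * real (idx_size (n i)) powr \<alpha> * ln (real (idx_size (n i)))"
  \<comment> \<open>The quotient of the two normalisers tends to this constant: the logarithm of the
    size is about d*b*ln i, and 1/(d*b) = (1 - \<alpha>)/(d*\<beta>).\<close>
  define \<rho> where "\<rho> = sqrt ((1 - \<alpha>) / (real d * \<beta>))"
  have \<rho>0: "\<rho> > 0" using \<alpha> d \<beta> by (simp add: \<rho>_def)
  have main: "AE \<omega> in M. limsup (\<lambda>i. ereal (?S \<omega> i / sqrt (?A i))) = ereal (sqrt (variance X0)) \<and>
      liminf (\<lambda>i. ereal (?S \<omega> i / sqrt (?A i))) = - ereal (sqrt (variance X0))"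
    using limsup_liminf_normalised_sums[OF _ _ disj _ int1 int2 intp _ \<gamma> growth p2 p\<gamma>]
    by (simp add: J_def cube_subset_pos_idx finite_cube \<mu>_def)
  have A_pos: "\<forall>\<^sub>F i in sequentially. ?A i > 0"
    using growth eventually_ge_at_top[of 3]
  proof eventually_elim
    case (elim i)
    have "0 < 1/2 * real i powr \<gamma>" using elim by simp
    with elim have "0 < real (card (J i))" by linarith
    with elim show ?case by simp
  qed
  have ratio: "(\<lambda>i. sqrt (?A i) / sqrt (?B i)) \<longlonglongrightarrow> \<rho>"
  proof -
    have ln_ratio: "(\<lambda>i. ln (real (N i)) / ln (real i)) \<longlonglongrightarrow> b"
    proof (rule Lim_transform_eventually)
      \<comment> \<open>Eventually ln N = ln(N/i^b) + b*ln i, and the first summand tends to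
        0.\<close>
      have "(\<lambda>i. ln (real (N i) / real i powr b)) \<longlonglongrightarrow> ln 1"
        by (intro tendsto_intros N_lim) auto
      moreover have "(\<lambda>i. inverse (ln (real i))) \<longlonglongrightarrow> 0" by real_asymp
      ultimately have "(\<lambda>i. ln (real (N i) / real i powr b) * inverse (ln (real i)) + b) \<longlonglongrightarrow> ln 1 * 0 + b"
        by (intro tendsto_add tendsto_mult tendsto_const)
      then show "(\<lambda>i. ln (real (N i) / real i powr b) * inverse (ln (real i)) + b) \<longlonglongrightarrow> b" by simp
      show "\<forall>\<^sub>F i in sequentially. ln (real (N i) / real i powr b) * inverse (ln (real i)) + b = ln (real (N i)) / ln (real i)"
        using N_pos eventually_ge_at_top[of 3]
      proof eventually_elim
        case (elim i)
        have "ln (real i) > 0" using elim by simp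
        then show ?case using elim by (simp add: ln_div ln_powr field_simps)
      qed
    qed
    have lim: "(\<lambda>i. sqrt ((real (K i) / real (N i) powr \<alpha>) ^ d / (real d * (ln (real (N i)) / ln (real i)))))
      \<longlonglongrightarrow> sqrt (1 ^ d / (real d * b))"
      using d b by (intro tendsto_intros K_lim ln_ratio) auto
    have \<rho>: "sqrt (1 ^ d / (real d * b)) = \<rho>" by (simp add: \<rho>_def b_def)
    have "\<forall>\<^sub>F i in sequentially. sqrt ((real (K i) / real (N i) powr \<alpha>) ^ d / (real d * (ln (real (N i)) / ln (real i))))
      = sqrt (?A i) / sqrt (?B i)"
      using N_pos eventually_ge_at_top[of 3]
    proof eventually_elim
      case (elim i)
      have "real (idx_size (n i)) = real (N i) ^ d" by (simp add: n idx_size_def prod_list_replicate)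
      then have "?B i = 2 * (real (N i) powr \<alpha>) ^ d * (real d * ln (real (N i)))"
        using elim by (simp add: powr_realpow[symmetric] powr_powr mult.commute ln_powr)
      then have "?A i / ?B i = (real (K i) / real (N i) powr \<alpha>) ^ d / (real d * (ln (real (N i)) / ln (real i)))"
        by (simp add: J_def card_cube power_divide)
      then show ?case by (metis real_sqrt_divide)
    qed
    from Lim_transform_eventually[OF lim this] show ?thesis unfolding \<rho> .
  qed
  have eq: "\<forall>\<^sub>F i in sequentially. ereal (block_sum X (n i) (idx_pow \<alpha> (n i)) \<omega> / sqrt (?B i))
    = ereal (sqrt (?A i) / sqrt (?B i)) * ereal (?S \<omega> i / sqrt (?A i))" for \<omega>
    using A_pos
  proof eventually_elim
    case (elim i)
    then have "real (card (J i)) \<noteq> 0" "ln (real i) \<noteq> 0"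
      by (metis less_irrefl mult_zero_left mult_zero_right)+
    moreover have "block_sum X (n i) (idx_pow \<alpha> (n i)) \<omega> = ?S \<omega> i"
      by (simp add: n block_sum_replicate J_def K_def)
    ultimately show ?case by simp
  qed
  \<comment> \<open>A factor converging to a positive finite limit passes through limsup and liminf
    in the extended reals, hence the need for \<rho> > 0.\<close>
  have ratio': "(\<lambda>i. ereal (sqrt (?A i) / sqrt (?B i))) \<longlonglongrightarrow> ereal \<rho>" using ratio by simp
  show ?thesis
    using main
  proof eventually_elim
    case (elim \<omega>)
    have 1: "limsup (\<lambda>i. ereal (block_sum X (n i) (idx_pow \<alpha> (n i)) \<omega> / sqrt (?B i)))
      = ereal \<rho> * ereal (sqrt (variance X0))"
      unfolding Limsup_eq[OF eq] elim[THEN conjunct1, symmetric]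
      by (rule ereal_limsup_lim_mult[OF ratio']) (use \<rho>0 in auto)
    have 2: "liminf (\<lambda>i. ereal (block_sum X (n i) (idx_pow \<alpha> (n i)) \<omega> / sqrt (?B i)))
      = ereal \<rho> * - ereal (sqrt (variance X0))"
      unfolding Liminf_eq[OF eq] elim[THEN conjunct2, symmetric]
      by (rule ereal_liminf_lim_mult[OF ratio']) (use \<rho>0 in auto)
    show ?case
      unfolding 1 2 assms(12) \<rho>_def[symmetric] by (simp add: mult.commute)
  qed
qed

end
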